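(* For all integers $k \geq 2$ and $g \geq 3$, we have \[ n(k,g,\underline{g+1}) \leq n(k,g+2,\underline{g+3}) - 2 . \]
   Context: All graphs are finite, simple and undirected. The girth of a graph is the length of a shortest cycle in it. A $(k,g,\underline{g+1})$-graph is a $k$-regular graph of girth $g$ that contains no cycle of length $g+1$. Such graphs exist for all $k\ge 2$, $g\ge 3$, and $n(k,g,\underline{g+1})$ denotes the smallest order (number of vertices) of a $(k,g,\underline{g+1})$-graph. *)

theory Defs
  imports
    "Graph_Theory.Pair_Digraph"
    "HOL-Library.Extended_Nat"
begin

text \<open>
  A finite simple undirected graph is a \<^locale>\<open>pair_graph\<close>: finite vertex set, and a finite,
  loop-free, symmetric set of arcs, so that the edge \<open>uv\<close> is the pair of arcs \<open>(u, v)\<close>, \<open>(v, u)\<close>.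
  In a symmetric digraph the closed walk \<open>u, v, u\<close> satisfies the digraph notion
  \<^const>\<open>pre_digraph.cycle\<close>, but it is not a cycle of the undirected graph; hence the
  condition \<open>3 \<le> l\<close> below.
\<close>

definition has_cycle_of_length :: "'a pair_pre_digraph \<Rightarrow> nat \<Rightarrow> bool" where
  "has_cycle_of_length G l \<longleftrightarrow>
     3 \<le> l \<and> (\<exists>p. pre_digraph.cycle (with_proj G) p \<and> length p = l)"

text \<open>The girth of an acyclic graph is \<open>\<infinity>\<close>.\<close>

definition girth :: "'a pair_pre_digraph \<Rightarrow> enat" where
  "girth G = (INF l \<in> {l. has_cycle_of_length G l}. enat l)"

text \<open>Each edge at \<open>v\<close> contributes exactly one arc leaving \<open>v\<close>, so the degree of \<open>v\<close> is its
  out-degree.\<close>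

definition regular_graph :: "nat \<Rightarrow> 'a pair_pre_digraph \<Rightarrow> bool" where
  "regular_graph k G \<longleftrightarrow> pair_graph G \<and> (\<forall>v \<in> pverts G. out_degree (with_proj G) v = k)"

text \<open>\<open>is_kg_graph k g G\<close>: \<open>G\<close> is a \<open>(k, g, g+1)\<close>-graph with the last entry underlined.\<close>

definition is_kg_graph :: "nat \<Rightarrow> nat \<Rightarrow> 'a pair_pre_digraph \<Rightarrow> bool" where
  "is_kg_graph k g G \<longleftrightarrow>
     regular_graph k G \<and> girth G = enat g \<and> \<not> has_cycle_of_length G (g + 1)"

text \<open>
  Every finite graph is isomorphic to one whose vertices are natural numbers, so fixing the vertex
  type loses no graph up to isomorphism. \<^const>\<open>Least\<close> is meaningful only if some
  \<open>is_kg_graph k g\<close> exists, which is the case for \<open>k \<ge> 2\<close> and \<open>g \<ge> 3\<close>.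
\<close>

definition min_order :: "nat \<Rightarrow> nat \<Rightarrow> nat" where
  "min_order k g =
     (LEAST n. \<exists>G :: nat pair_pre_digraph. is_kg_graph k g G \<and> card (pverts G) = n)"

end

theory Submission
  imports Defs "HOL-Combinatorics.Permutations"
begin

text \<open>
  Let \<open>G\<close> be a smallest \<open>k\<close>-regular graph of girth \<open>g + 2\<close> without \<open>(g + 3)\<close>-cycles and let \<open>uv\<close> be an
  edge of a \<open>(g + 2)\<close>-cycle. Delete \<open>u\<close> and \<open>v\<close> and join their former neighbours by a perfect
  matching between the two neighbourhoods that pairs the neighbours on the cycle. A cycle
  through one new edge arises from a cycle of \<open>G\<close> by replacing a path of length 3 by an edge, so
  its length is \<open>g\<close> or at least \<open>g + 2\<close>; a cycle through several new edges has length at least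
  \<open>2 g\<close>.

  Because the minimal order is a \<open>LEAST\<close>, this needs some such graph \<open>G\<close> to exist. Take a \<open>k\<close>-regular
  graph of large girth, namely a Cayley graph of permutations of a ball in the \<open>k\<close>-regular tree, and
  switch the two end edges of a path on \<open>g + 2\<close> vertices to create a single cycle of length \<open>g\<close>.
\<close>

subsection \<open>Paths and cycles as vertex lists\<close>

definition vpath :: "'a rel \<Rightarrow> 'a list \<Rightarrow> bool" where
  "vpath E xs \<longleftrightarrow> xs \<noteq> [] \<and> distinct xs \<and> successively (\<lambda>x y. (x, y) \<in> E) xs"

definition vcycle :: "'a rel \<Rightarrow> 'a list \<Rightarrow> bool" where
  "vcycle E xs \<longleftrightarrow> 3 \<le> length xs \<and> vpath E xs \<and> (last xs, hd xs) \<in> E"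

definition regular_rel :: "nat \<Rightarrow> 'a set \<Rightarrow> 'a rel \<Rightarrow> bool" where
  "regular_rel k V E \<longleftrightarrow> finite V \<and> E \<subseteq> V \<times> V \<and> sym E \<and> irrefl E \<and> (\<forall>v\<in>V. card (E `` {v}) = k)"

text \<open>Girth \<open>g\<close> and the absence of cycles of length \<open>g + 1\<close> are
  merged into one condition on cycle lengths, which avoids infima in \<open>enat\<close>.\<close>

definition kg_rel :: "nat \<Rightarrow> nat \<Rightarrow> 'a set \<Rightarrow> 'a rel \<Rightarrow> bool" where
  "kg_rel k g V E \<longleftrightarrow> regular_rel k V E \<and> (\<exists>xs. vcycle E xs \<and> length xs = g) \<and>
     (\<forall>xs. vcycle E xs \<longrightarrow> length xs = g \<or> g + 2 \<le> length xs)"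

lemma vpath_mono: "vpath A xs \<Longrightarrow> A \<subseteq> B \<Longrightarrow> vpath B xs"
  unfolding vpath_def by (auto intro: successively_mono)

lemma vpath_rev: "sym E \<Longrightarrow> vpath E (rev xs) \<longleftrightarrow> vpath E xs"
  unfolding vpath_def by (auto dest: symD elim!: successively_mono)

lemma vpath_Cons: "vpath E (x # xs) \<longleftrightarrow> xs = [] \<or> x \<notin> set xs \<and> (x, hd xs) \<in> E \<and> vpath E xs"
  unfolding vpath_def by (auto simp: successively_Cons)

text \<open>From two vertices on, every vertex is an end of an arc. A one-vertex list is a path in
  every relation, wherever its vertex lies.\<close>

lemma vpath_subset:
  assumes "vpath E xs" "E \<subseteq> V \<times> V" "2 \<le> length xs"
  shows "set xs \<subseteq> V"
  using assms
proof (induction xs)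
  case (Cons x xs)
  then show ?case
    by (cases xs; cases "tl xs") (auto simp: vpath_Cons)
qed auto

subsection \<open>Pair digraphs as relations\<close>

text \<open>The start is kept apart from the list, so that the list consists of the heads of the
  arcs and has as many entries as the walk has arcs.\<close>

primrec walk_arcs :: "'a \<Rightarrow> 'a list \<Rightarrow> ('a \<times> 'a) list" where
  "walk_arcs u [] = []"
| "walk_arcs u (x # xs) = (u, x) # walk_arcs x xs"

lemma pcas_iff_walk_arcs:
  "pcas u p v \<longleftrightarrow> p = walk_arcs u (map snd p) \<and> v = last (u # map snd p)"
proof (induction p arbitrary: u)
  case (Cons e p)
  show ?case
    by (cases e) (simp add: Cons.IH conj_commute conj_left_commute eq_commute[of u])
qed auto

lemma map_snd_walk_arcs [simp]: "map snd (walk_arcs u xs) = xs"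
  by (induction xs arbitrary: u) auto

lemma pawalk_verts_walk_arcs: "pawalk_verts u (walk_arcs u xs) = u # xs"
  by (induction xs arbitrary: u) auto

lemma walk_arcs_subset_iff:
  "set (walk_arcs u xs) \<subseteq> E \<longleftrightarrow> successively (\<lambda>x y. (x, y) \<in> E) (u # xs)"
  by (induction xs arbitrary: u) (auto simp: successively_Cons)

text \<open>A closed walk from \<open>u\<close> with heads \<open>xs\<close> ends in
  \<open>u = last xs\<close>. Dropping the start loses nothing: the first arc
  \<open>(u, hd xs)\<close> becomes the closing arc \<open>(last xs, hd xs)\<close> of
  \<open>vcycle\<close>.\<close>

lemma has_cycle_of_length_iff:
  assumes "pair_wf_digraph G"
  shows "has_cycle_of_length G l \<longleftrightarrow> (\<exists>xs. vcycle (parcs G) xs \<and> length xs = l)"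
proof -
  interpret pair_wf_digraph G by fact
  have *: "cycle p \<longleftrightarrow> (\<exists>u xs. p = walk_arcs u xs \<and> u \<in> pverts G \<and> xs \<noteq> [] \<and> distinct xs \<and>
      last xs = u \<and> successively (\<lambda>x y. (x, y) \<in> parcs G) (u # xs))" for p
  proof
    assume "cycle p"
    then obtain u where u: "u \<in> pverts G" "set p \<subseteq> parcs G" "pcas u p u" "p \<noteq> []"
      "distinct (tl (pawalk_verts u p))"
      unfolding cycle_def awalk_def by auto
    define xs where "xs = map snd p"
    have p: "p = walk_arcs u xs" and l: "u = last (u # xs)"
      using u(3) unfolding pcas_iff_walk_arcs xs_def by auto
    have "xs \<noteq> []" using u(4) by (simp add: xs_def)
    then show "\<exists>u xs. p = walk_arcs u xs \<and> u \<in> pverts G \<and> xs \<noteq> [] \<and> distinct xs \<and>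
      last xs = u \<and> successively (\<lambda>x y. (x, y) \<in> parcs G) (u # xs)"
      using u p l walk_arcs_subset_iff pawalk_verts_walk_arcs
      by (metis last_ConsR list.sel(3))
  next
    assume "\<exists>u xs. p = walk_arcs u xs \<and> u \<in> pverts G \<and> xs \<noteq> [] \<and> distinct xs \<and>
      last xs = u \<and> successively (\<lambda>x y. (x, y) \<in> parcs G) (u # xs)"
    then obtain u xs where *: "p = walk_arcs u xs" "u \<in> pverts G" "xs \<noteq> []" "distinct xs"
      "last xs = u" "successively (\<lambda>x y. (x, y) \<in> parcs G) (u # xs)" by blast
    then have "set p \<subseteq> parcs G" "pcas u p u" "p \<noteq> []" "pawalk_verts u p = u # xs"
      by (auto simp: walk_arcs_subset_iff pawalk_verts_walk_arcs pcas_iff_walk_arcs neq_Nil_conv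
          simp del: successively.simps)
    then show "cycle p"
      using * unfolding cycle_def awalk_def by auto
  qed
  have len: "length (walk_arcs u xs) = length xs" for u :: 'a and xs
    by (metis length_map map_snd_walk_arcs)
  show ?thesis
    unfolding has_cycle_of_length_def
  proof safe
    fix p assume "3 \<le> length p" "cycle p" "l = length p"
    then show "\<exists>xs. vcycle (parcs G) xs \<and> length xs = length p"
      unfolding * vcycle_def vpath_def by (auto simp: len successively_Cons)
  next
    fix xs assume "vcycle (parcs G) xs" "l = length xs"
    then have "cycle (walk_arcs (last xs) xs)"
      unfolding * vcycle_def vpath_def
      by (intro exI[of _ "last xs"] exI[of _ xs]) (auto simp: successively_Cons dest: wellformed')
    then show "\<exists>p. cycle p \<and> length p = length xs"
      using len by blast
  qed (auto simp: vcycle_def)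
qed

text \<open>A finite infimum forces \<open>S\<close> to be nonempty, since the infimum of the empty
  set is infinite, and by well-ordering it is then attained.\<close>

lemma Inf_enat_image_eq_iff:
  "(INF l \<in> S. enat l) = enat g \<longleftrightarrow> g \<in> S \<and> (\<forall>l\<in>S. g \<le> l)"
proof
  assume L: "(INF l \<in> S. enat l) = enat g"
  then have "S \<noteq> {}" by (auto simp: top_enat_def)
  then have "Inf (enat ` S) \<in> enat ` S"
    by (metis (no_types, lifting) LeastI_ex Inf_enat_def all_not_in_conv image_is_empty)
  then have "g \<in> S" using L by auto
  moreover have "g \<le> l" if "l \<in> S" for l
    using L INF_lower[OF that, of enat] by simp
  ultimately show "g \<in> S \<and> (\<forall>l\<in>S. g \<le> l)" by blast
next
  assume "g \<in> S \<and> (\<forall>l\<in>S. g \<le> l)"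
  then show "(INF l \<in> S. enat l) = enat g"
    by (intro antisym INF_greatest INF_lower) auto
qed

lemma regular_graph_iff: "regular_graph k G \<longleftrightarrow> regular_rel k (pverts G) (parcs G)"
proof -
  have "pair_graph G \<longleftrightarrow>
      finite (pverts G) \<and> parcs G \<subseteq> pverts G \<times> pverts G \<and> sym (parcs G) \<and> irrefl (parcs G)"
  proof
    assume "pair_graph G"
    then interpret pair_graph G .
    show "finite (pverts G) \<and> parcs G \<subseteq> pverts G \<times> pverts G \<and> sym (parcs G) \<and> irrefl (parcs G)"
      using pair_finite_verts arcs_symmetric no_loops'
      by (auto simp: sym_def irrefl_def dest: wellformed')
  next
    assume *: "finite (pverts G) \<and> parcs G \<subseteq> pverts G \<times> pverts G \<and> sym (parcs G) \<and> irrefl (parcs G)"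
    then have "finite (parcs G)" by (meson finite_SigmaI finite_subset)
    with * show "pair_graph G"
      by unfold_locales (auto simp: symmetric_def irrefl_def)
  qed
  moreover have "out_degree (with_proj G) v = card (parcs G `` {v})" for v
  proof -
    have "out_arcs (with_proj G) v = Pair v ` (parcs G `` {v})"
      by (auto simp: out_arcs_def)
    then show ?thesis
      unfolding out_degree_def by (simp add: card_image inj_on_def)
  qed
  ultimately show ?thesis
    unfolding regular_graph_def regular_rel_def by auto
qed

lemma is_kg_graph_iff: "is_kg_graph k g G \<longleftrightarrow> kg_rel k g (pverts G) (parcs G)"
proof (cases "regular_graph k G")
  case True
  then interpret pair_graph G by (simp add: regular_graph_def)
  have "pair_wf_digraph G" ..
  note cyc = has_cycle_of_length_iff[OF this]
  have "g + 2 \<le> l \<longleftrightarrow> g \<le> l \<and> l \<noteq> g \<and> l \<noteq> g + 1" for l by auto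
  with True show ?thesis
    unfolding is_kg_graph_def kg_rel_def girth_def Inf_enat_image_eq_iff cyc
    by (auto simp: regular_graph_iff)
next
  case False
  then show ?thesis
    unfolding is_kg_graph_def kg_rel_def by (simp add: regular_graph_iff)
qed

section \<open>Invariance under injective renaming of vertices\<close>

lemma map_prod_image_iff:
  assumes "inj_on f V" "E \<subseteq> V \<times> V" "x \<in> V" "y \<in> V"
  shows "(f x, f y) \<in> map_prod f f ` E \<longleftrightarrow> (x, y) \<in> E"
proof
  assume "(f x, f y) \<in> map_prod f f ` E"
  then obtain a b where ab: "(a, b) \<in> E" "f x = f a" "f y = f b" by auto
  then have "x = a" "y = b"
    using assms by (auto dest: inj_onD)
  with ab show "(x, y) \<in> E" by simp
qed auto

lemma vcycle_map_iff:
  assumes "inj_on f V" "E \<subseteq> V \<times> V"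
  shows "vcycle (map_prod f f ` E) ys \<longleftrightarrow> (\<exists>xs. vcycle E xs \<and> ys = map f xs)"
proof
  assume L: "vcycle (map_prod f f ` E) ys"
  have "map_prod f f ` E \<subseteq> f ` V \<times> f ` V" using assms(2) by auto
  then have "set ys \<subseteq> f ` V"
    using L vpath_subset[of _ ys "f ` V"] by (auto simp: vcycle_def)
  then have "ys \<in> map f ` lists V"
    by (simp flip: lists_image add: in_lists_conv_set subset_iff)
  then obtain xs where ys: "ys = map f xs" and xs: "set xs \<subseteq> V"
    by auto
  note * = map_prod_image_iff[OF assms]
  have "xs \<noteq> []" using L by (auto simp: ys vcycle_def)
  then have "last xs \<in> V" "hd xs \<in> V" using xs by auto
  then have "vcycle E xs"
    using L \<open>xs \<noteq> []\<close> xs unfolding ys vcycle_def vpath_def successively_map distinct_map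
    by (auto simp: last_map hd_map * subsetD simp del: image_iff map_prod_imageI elim!: successively_mono dest: *[THEN iffD1, rotated 2])
  with ys show "\<exists>xs. vcycle E xs \<and> ys = map f xs" by blast
next
  assume "\<exists>xs. vcycle E xs \<and> ys = map f xs"
  then obtain xs where xs: "vcycle E xs" "ys = map f xs" by blast
  then have "set xs \<subseteq> V" using assms(2) vpath_subset[of E xs V] by (auto simp: vcycle_def)
  then show "vcycle (map_prod f f ` E) ys"
    using xs assms(1) unfolding vcycle_def vpath_def
    by (auto simp: successively_map last_map hd_map distinct_map intro: inj_on_subset elim!: successively_mono)
qed

lemma kg_rel_map:
  assumes "kg_rel k g V E" "inj_on f V"
  shows "kg_rel k g (f ` V) (map_prod f f ` E)"
proof -
  have r: "finite V" "E \<subseteq> V \<times> V" "sym E" "irrefl E" "\<forall>v\<in>V. card (E `` {v}) = k"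
    using assms(1) by (auto simp: kg_rel_def regular_rel_def)
  have "card ((map_prod f f ` E) `` {f v}) = k" if "v \<in> V" for v
  proof -
    have "(map_prod f f ` E) `` {f v} = f ` (E `` {v})"
    proof (intro subset_antisym subsetI)
      fix y assume y: "y \<in> (map_prod f f ` E) `` {f v}"
      then obtain b where "y = f b" "b \<in> V" using r(2) by auto
      with y show "y \<in> f ` (E `` {v})"
        using map_prod_image_iff[OF assms(2) r(2) that, of b] by auto
    qed auto
    moreover have "inj_on f (E `` {v})"
      using r(2) by (intro inj_on_subset[OF assms(2)]) auto
    ultimately show ?thesis using r(5) that by (simp add: card_image)
  qed
  moreover have "irrefl (map_prod f f ` E)"
    unfolding irrefl_def
  proof (intro allI notI)
    fix a assume "(a, a) \<in> map_prod f f ` E"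
    then obtain x y where xy: "(x, y) \<in> E" "f x = f y" by auto
    then have "x = y" using r(2) inj_onD[OF assms(2), of x y] by auto
    with xy r(4) show False by (auto simp: irrefl_def)
  qed
  moreover have "sym (map_prod f f ` E)"
    using r(3) by (auto intro!: symI dest: symD)
  ultimately have "regular_rel k (f ` V) (map_prod f f ` E)"
    unfolding regular_rel_def using r(1,2) by auto
  then show ?thesis
    using assms(1) unfolding kg_rel_def vcycle_map_iff[OF assms(2) r(2)]
    by (metis length_map)
qed

text \<open>\<open>min_order\<close> ranges over graphs on natural numbers only; this brings in
  graphs on other types, such as the one on permutations below.\<close>

lemma kg_rel_imp_nat:
  fixes V :: "'a set"
  assumes "kg_rel k g V E"
  shows "\<exists>G :: nat pair_pre_digraph. is_kg_graph k g G \<and> card (pverts G) = card V"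
proof -
  have "finite V" using assms by (simp add: kg_rel_def regular_rel_def)
  from finite_imp_inj_to_nat_seg[OF this] obtain f :: "'a \<Rightarrow> nat" where f: "inj_on f V"
    by blast
  then show ?thesis
    using kg_rel_map[OF assms f] card_image[OF f]
    by (intro exI[of _ "\<lparr>pverts = f ` V, parcs = map_prod f f ` E\<rparr>"]) (simp add: is_kg_graph_iff)
qed

subsection \<open>Replacing edges by a matching\<close>

text \<open>The list is cut at the first and at the last violation of \<open>P\<close>. The two
  coincide exactly when \<open>ms\<close> is empty.\<close>

lemma not_successively_split:
  assumes "\<not> successively P zs"
  obtains as ms ds where "zs = as @ ms @ ds" "as \<noteq> []" "ds \<noteq> []" "successively P as" "successively P ds"
    "\<not> P (last as) (hd (ms @ ds))" "\<not> P (last (as @ ms)) (hd ds)"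
proof -
  have first: "\<exists>as bs. zs = as @ bs \<and> as \<noteq> [] \<and> bs \<noteq> [] \<and> successively P as \<and> \<not> P (last as) (hd bs)"
    if "\<not> successively P zs" for P and zs :: "'a list"
    using that
  proof (induction zs)
    case (Cons z zs)
    then have ne: "zs \<noteq> []" by auto
    show ?case
    proof (cases "P z (hd zs)")
      case True
      then obtain as bs where "zs = as @ bs" "as \<noteq> []" "bs \<noteq> []" "successively P as" "\<not> P (last as) (hd bs)"
        using Cons ne by (auto simp: successively_Cons)
      then show ?thesis
        using True by (intro exI[of _ "z # as"] exI[of _ bs]) (auto simp: successively_Cons)
    next
      case False
      then show ?thesis using ne by (intro exI[of _ "[z]"] exI[of _ zs]) auto
    qed
  qed auto
  from first[OF assms] obtain as bs where as: "zs = as @ bs" "as \<noteq> []" "bs \<noteq> []" "successively P as"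
    "\<not> P (last as) (hd bs)" by blast
  show ?thesis
  proof (cases "successively P bs")
    case True
    then show ?thesis using as that[of as "[]" bs] by simp
  next
    case False
    \<comment> \<open>The last violation is the first one in the reversed list.\<close>
    then have "\<not> successively (\<lambda>x y. P y x) (rev bs)" by simp
    from first[OF this] obtain ds ms where *: "rev bs = ds @ ms" "ds \<noteq> []" "ms \<noteq> []"
      "successively (\<lambda>x y. P y x) ds" "\<not> P (hd ms) (last ds)" by blast
    from *(1) have "bs = rev ms @ rev ds" by (metis rev_append rev_rev_ident)
    then show ?thesis
      using * as that[of as "rev ms" "rev ds"] by (simp add: last_rev hd_rev)
  qed
qed

lemma distinct_hd_eq_last:
  assumes "distinct xs" "xs \<noteq> []" "hd xs = last xs"
  shows "length xs = 1"
  using assms by (cases xs) (auto split: if_splits)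

lemma vcycle_rotate: "vcycle E (ps @ qs) \<Longrightarrow> vcycle E (qs @ ps)"
  unfolding vcycle_def vpath_def
  by (cases "ps = []"; cases "qs = []") (auto simp: successively_append_iff)

text \<open>A cycle through two or more edges of the matching contains two disjoint paths of \<open>A\<close>,
  namely the pieces next to one of these edges.\<close>

lemma vcycle_splice:
  assumes cyc: "vcycle (A \<union> M) xs"
    and M: "sym M" "single_valued M"
    and far: "\<And>ys. \<lbrakk>vpath A ys; hd ys \<in> Domain M; last ys \<in> Domain M; hd ys \<noteq> last ys\<rbrakk> \<Longrightarrow> s \<le> length ys"
  obtains "vcycle A xs"
    | ys where "vpath A ys" "(last ys, hd ys) \<in> M" "length ys = length xs"
    | "2 * s \<le> length xs"
proof (cases "vcycle A xs")
  case False
  \<comment> \<open>The cycle is rotated so that an edge of the matching becomes its closing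
    edge.\<close>
  have "\<exists>zs. length zs = length xs \<and> vcycle (A \<union> M) zs \<and> (last zs, hd zs) \<in> M"
  proof (cases "(last xs, hd xs) \<in> M")
    case False
    with \<open>\<not> vcycle A xs\<close> cyc have "\<not> successively (\<lambda>x y. (x, y) \<in> A) xs"
      by (auto simp: vcycle_def vpath_def)
    then obtain ps ms ds where *: "xs = ps @ ms @ ds" "ps \<noteq> []" "ds \<noteq> []"
      "(last ps, hd (ms @ ds)) \<notin> A" by (rule not_successively_split)
    then have "(last ps, hd (ms @ ds)) \<in> A \<union> M"
      using cyc by (auto simp: vcycle_def vpath_def successively_append_iff)
    then show ?thesis
      using * cyc vcycle_rotate[of "A \<union> M" ps "ms @ ds"]
      by (intro exI[of _ "(ms @ ds) @ ps"]) (auto simp: hd_append)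
  qed (use cyc in auto)
  then obtain zs where len: "length zs = length xs" and zs: "vcycle (A \<union> M) zs" "(last zs, hd zs) \<in> M"
    by blast
  then have d: "distinct zs" "3 \<le> length zs" by (auto simp: vcycle_def vpath_def)
  have sv: "y = z" if "(x, y) \<in> M" "(x, z) \<in> M" for x y z
    using M(2) that by (auto dest: single_valuedD)
  show ?thesis
  proof (cases "successively (\<lambda>x y. (x, y) \<in> A) zs")
    case True
    then have "vpath A zs" using zs by (auto simp: vcycle_def vpath_def)
    then show ?thesis using that(2) zs len by blast
  next
    case False
    then obtain as ms ds where z: "zs = as @ ms @ ds" "as \<noteq> []" "ds \<noteq> []"
      and sA: "successively (\<lambda>x y. (x, y) \<in> A) as" "successively (\<lambda>x y. (x, y) \<in> A) ds"
      and nA: "(last as, hd (ms @ ds)) \<notin> A" "(last (as @ ms), hd ds) \<notin> A"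
      by (rule not_successively_split)
    have sAM: "successively (\<lambda>x y. (x, y) \<in> A \<union> M) (as @ ms @ ds)"
      using zs(1) z(1) by (simp add: vcycle_def vpath_def)
    have nM: "(last as, hd (ms @ ds)) \<in> M" "(last (as @ ms), hd ds) \<in> M"
      using sAM z nA successively_append_iff[of _ "as" "ms @ ds"]
        successively_append_iff[of "\<lambda>x y. (x, y) \<in> A \<union> M" "as @ ms" "ds"]
      by auto
    have endM: "(last ds, hd as) \<in> M" "(hd as, last ds) \<in> M"
      using zs(2) z M(1) by (auto dest: symD)
    have "s \<le> length as"
    proof (rule far)
      show "vpath A as" using sA z d by (auto simp: vpath_def)
      show "hd as \<in> Domain M" "last as \<in> Domain M" using endM nM by auto
      \<comment> \<open>If \<open>as\<close> were a single vertex, its two neighbours on the cycle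
        would both be its partner in the matching. The rest would then be a single vertex too, and
        the cycle would have only two vertices.\<close>
      show "hd as \<noteq> last as"
      proof
        assume eq: "hd as = last as"
        then have 1: "length as = 1" using d z(1,2) by (intro distinct_hd_eq_last) auto
        have "hd (ms @ ds) = last (ms @ ds)" using sv[OF nM(1)] endM(2) eq z by auto
        then have "length (ms @ ds) = 1"
          using d z(1,3) by (intro distinct_hd_eq_last) auto
        with 1 d z show False by auto
      qed
    qed
    moreover have "s \<le> length ds"
    proof (rule far)
      show "vpath A ds" using sA z d by (auto simp: vpath_def)
      show "hd ds \<in> Domain M" "last ds \<in> Domain M" using endM nM M(1) by (auto dest: symD)
      show "hd ds \<noteq> last ds"
      proof
        assume eq: "hd ds = last ds"
        then have 1: "length ds = 1" using d z(1,3) by (intro distinct_hd_eq_last) auto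
        have "(last ds, last (as @ ms)) \<in> M" using nM(2) M(1) eq by (auto dest: symD)
        then have "hd (as @ ms) = last (as @ ms)" using sv[OF endM(1)] z by auto
        then have "length (as @ ms) = 1"
          using d z(1,2) by (intro distinct_hd_eq_last) auto
        with 1 d z show False by auto
      qed
    qed
    ultimately show ?thesis using that(3) z len by auto
  qed
qed (use that in blast)

text \<open>This keeps degrees constant: an end of a new edge loses one neighbour and gains one that
  it did not have.\<close>

lemma card_swap_elem:
  assumes "finite S" "a \<in> S" "b \<notin> S"
  shows "card (insert b (S - {a})) = card S"
  using assms by (metis DiffD1 card_Suc_Diff1 card_insert_disjoint finite_Diff)

subsection \<open>Deleting two adjacent vertices\<close>

lemma kg_rel_delete_edge:
  fixes V :: "'a set"
  assumes kg: "kg_rel k (g + 2) V E" and g: "3 \<le> g"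
  obtains V' :: "'a set" and E' where "kg_rel k g V' E'" "card V' + 2 = card V"
proof -
  have finV: "finite V" and EV: "E \<subseteq> V \<times> V" and symE: "sym E" and irr: "irrefl E"
    and deg: "\<And>v. v \<in> V \<Longrightarrow> card (E `` {v}) = k"
    and cycE: "\<And>xs. vcycle E xs \<Longrightarrow> length xs = g + 2 \<or> g + 4 \<le> length xs"
    using kg unfolding kg_rel_def regular_rel_def by auto
  have sE: "(y, x) \<in> E" if "(x, y) \<in> E" for x y using symE that by (auto dest: symD)
  have iE: "(x, x) \<notin> E" for x using irr by (auto simp: irrefl_def)
  have finN: "finite (E `` {x})" for x
    using finV EV by (auto intro: finite_subset[of _ V])
  obtain us where us: "vcycle E us" "length us = g + 2"
    using kg unfolding kg_rel_def by blast
  obtain u us' where us': "us = u # us'" using us(2) by (cases us) auto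
  obtain v zs where zs: "us' = v # zs" using us(2) us' g by (cases us') auto
  have lz: "length zs = g" "zs \<noteq> []" using us(2) us' zs g by auto
  \<comment> \<open>The cycle is \<open>u, v, b, ..., a\<close>, so removing \<open>u\<close> and
    \<open>v\<close> leaves the path \<open>zs\<close> on \<open>g\<close> vertices from a neighbour
    of \<open>v\<close> to a neighbour of \<open>u\<close>.\<close>
  define a b where "a = last zs" and "b = hd zs"
  have uv: "(u, v) \<in> E" "u \<noteq> v" "u \<notin> set zs" "v \<notin> set zs" and vb: "(v, b) \<in> E" and au: "(a, u) \<in> E"
    and pz: "vpath E zs"
    using us(1) lz unfolding us' zs vcycle_def vpath_Cons a_def b_def by auto
  have ab: "a \<in> set zs" "b \<in> set zs" using lz by (auto simp: a_def b_def)
  have uvV: "u \<in> V" "v \<in> V" using uv(1) EV by auto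
  \<comment> \<open>All cycles have at least \<open>g + 2 \<ge> 5\<close> vertices. The absence of
    triangles makes the two neighbourhoods disjoint; the absence of 4-cycles makes every matching
    edge a new edge.\<close>
  have no3: False if "(x, y) \<in> E" "(y, z) \<in> E" "(z, x) \<in> E" for x y z
  proof -
    have "vcycle E [x, y, z]" using that iE by (auto simp: vcycle_def vpath_def)
    then show False using cycE g by fastforce
  qed
  have no4: False if "(x, y) \<in> E" "(y, z) \<in> E" "(z, w) \<in> E" "(w, x) \<in> E" "x \<noteq> z" "y \<noteq> w" for x y z w
  proof -
    have "vcycle E [x, y, z, w]" using that iE by (auto simp: vcycle_def vpath_def)
    then show False using cycE g by fastforce
  qed
  define U W where "U = E `` {u} - {v}" and "W = E `` {v} - {u}"
  have aU: "a \<in> U" and bW: "b \<in> W" using au vb sE uv ab by (auto simp: U_def W_def)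
  have "card U = card W"
    using deg uvV uv(1) sE[OF uv(1)] by (simp add: U_def W_def)
  then have "card (U - {a}) = card (W - {b})" using aU bW by simp
  then obtain h0 where h0: "bij_betw h0 (U - {a}) (W - {b})"
    using finite_same_card_bij[of "U - {a}" "W - {b}"] finN by (auto simp: U_def W_def)
  \<comment> \<open>The bijection is made to match \<open>a\<close> with \<open>b\<close>, so that
    the new edge closes \<open>zs\<close> to a cycle of length \<open>g\<close>.\<close>
  define h where "h = h0(a := b)"
  have "bij_betw h0 (U - {a}) (W - {b}) \<longleftrightarrow> bij_betw h (U - {a}) (W - {b})"
    by (rule bij_betw_cong) (simp add: h_def)
  with h0 have "bij_betw h (insert a (U - {a})) (insert b (W - {b}))"
    using notIn_Un_bij_betw[of a "U - {a}" h "W - {b}"] by (simp add: h_def)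
  then have h: "bij_betw h U W" using aU bW by (simp add: insert_absorb)
  have hab: "h a = b" by (simp add: h_def)
  have hW: "h x \<in> W" if "x \<in> U" for x using h that by (auto simp: bij_betw_def)
  have hinj: "x = y" if "x \<in> U" "y \<in> U" "h x = h y" for x y
    using h that by (auto simp: bij_betw_def dest: inj_onD)
  have disj: "U \<inter> W = {}" using no3[OF uv(1)] sE by (auto simp: U_def W_def)
  define V' where "V' = V - {u, v}"
  define A where "A = E \<inter> V' \<times> V'"
  define M where "M = {(x, h x) |x. x \<in> U} \<union> {(h x, x) |x. x \<in> U}"
  have UV': "U \<subseteq> V'" "W \<subseteq> V'" using EV iE by (auto simp: U_def W_def V'_def)
  have M_U: "(x, y) \<in> M \<longleftrightarrow> y = h x" if "x \<in> U" for x y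
    using that disj hW by (auto simp: M_def)
  have M_W: "(h x, y) \<in> M \<longleftrightarrow> y = x" if "x \<in> U" for x y
    using that disj hW hinj by (auto simp: M_def)
  have DomM: "Domain M = U \<union> W"
    using h by (auto simp: M_def bij_betw_def)
  have symM: "sym M" by (auto simp: sym_def M_def)
  have svM: "single_valued M"
    using disj hW hinj by (auto simp: single_valued_def M_def)
  have symA: "sym A" using symE by (auto simp: sym_def A_def)
  have AE: "A \<subseteq> E" by (auto simp: A_def)
  \<comment> \<open>The condition on \<open>hd ys\<close> places a one-vertex path in
    \<open>V'\<close>; longer paths lie there because the arcs of \<open>A\<close> do.\<close>
  have pathA: "vpath E ys \<and> u \<notin> set ys \<and> v \<notin> set ys"
    if "vpath A ys" "hd ys \<in> U \<union> W" for ys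
  proof -
    have "set ys \<subseteq> V'"
    proof (cases "2 \<le> length ys")
      case True
      then show ?thesis using vpath_subset[OF that(1)] by (auto simp: A_def)
    next
      case False
      then have "ys = [hd ys]" using that(1) by (cases ys; cases "tl ys") (auto simp: vpath_def)
      then show ?thesis using that(2) UV' by (metis Un_iff empty_set empty_subsetI insert_subset list.simps(15) subsetD)
    qed
    then show ?thesis using vpath_mono[OF that(1) AE] by (auto simp: V'_def)
  qed
  \<comment> \<open>Two ends on the same side have the deleted neighbour \<open>c\<close> in common,
    through which the path closes to a cycle of \<open>E\<close>.\<close>
  have far1: "g \<le> length ys"
    if "vpath A ys" "hd ys \<in> S" "last ys \<in> S" "hd ys \<noteq> last ys" "S = U \<and> c = u \<or> S = W \<and> c = v" for ys S c
  proof -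
    have "2 \<le> length ys" using that(1,4) by (cases ys; cases "tl ys") (auto simp: vpath_def)
    moreover have "vpath E ys" "u \<notin> set ys" "v \<notin> set ys" using pathA that by blast+
    ultimately have "vcycle E (c # ys)"
      using that sE by (auto simp: vcycle_def vpath_Cons U_def W_def)
    then show ?thesis using cycE by fastforce
  qed
  \<comment> \<open>Closing the path through \<open>u\<close> and \<open>v\<close> adds two
    vertices, so the cycle lengths \<open>g + 2\<close> and at least \<open>g + 4\<close> of
    \<open>E\<close> drop by two.\<close>
  have far2: "length ys = g \<or> g + 2 \<le> length ys"
    if "vpath A ys" "hd ys \<in> U" "last ys \<in> W" for ys
  proof -
    have "ys \<noteq> []" using that(1) by (auto simp: vpath_def)
    moreover have "vpath E ys" "u \<notin> set ys" "v \<notin> set ys" using pathA that by blast+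
    ultimately have "vcycle E (v # u # ys)"
      using that sE uv by (auto simp: vcycle_def vpath_Cons U_def W_def Suc_le_eq)
    then show ?thesis using cycE by fastforce
  qed
  have far2': "length ys = g \<or> g + 2 \<le> length ys"
    if "vpath A ys" "hd ys \<in> W" "last ys \<in> U" for ys
    using far2[of "rev ys"] that vpath_rev[OF symA, of ys] by (auto simp: hd_rev last_rev)
  have cyc': "length xs = g \<or> g + 2 \<le> length xs" if cyc: "vcycle (A \<union> M) xs" for xs
  proof (rule vcycle_splice[OF cyc symM svM, of g])
    show "g \<le> length ys" if "vpath A ys" "hd ys \<in> Domain M" "last ys \<in> Domain M" "hd ys \<noteq> last ys" for ys
      using that far1[of ys U u] far1[of ys W v] far2[of ys] far2'[of ys] unfolding DomM by auto
  next
    assume "vcycle A xs"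
    then have "vcycle E xs" using vpath_mono[of A xs E] AE by (auto simp: vcycle_def)
    then show ?thesis using cycE by fastforce
  next
    fix ys assume ys: "vpath A ys" "(last ys, hd ys) \<in> M" "length ys = length xs"
    from ys(2) have "last ys \<in> U \<and> hd ys \<in> W \<or> hd ys \<in> U \<and> last ys \<in> W"
      using hW by (auto simp: M_def)
    then show ?thesis using far2 far2' ys by metis
  \<comment> \<open>What remains is a cycle with at least \<open>2 * g\<close> vertices, and
    \<open>g + 2 \<le> 2 * g\<close>.\<close>
  qed (use g in auto)
  have "vpath A zs"
  proof -
    have "set zs \<subseteq> V" using vpath_subset[OF pz EV] lz g by auto
    then have "set zs \<subseteq> V'" using uv by (auto simp: V'_def)
    then show ?thesis using pz by (auto simp: vpath_def A_def elim!: successively_mono)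
  qed
  then have "vcycle (A \<union> M) zs"
    using lz g vpath_mono[of A zs "A \<union> M"] M_U[OF aU] hab by (auto simp: vcycle_def a_def b_def)
  moreover have "regular_rel k V' (A \<union> M)"
  proof -
    have "card ((A \<union> M) `` {x}) = k" if x: "x \<in> V'" for x
    proof -
      have xV: "x \<in> V" "x \<noteq> u" "x \<noteq> v" using x by (auto simp: V'_def)
      have Ax: "A `` {x} = E `` {x} - {u, v}" using x EV by (auto simp: A_def V'_def)
      consider "x \<in> U" | y where "y \<in> U" "x = h y" | "x \<notin> U" "x \<notin> W"
        using h by (auto simp: bij_betw_def)
      then show ?thesis
      proof cases
        case 1
        then have xu: "(x, u) \<in> E" "(x, v) \<notin> E" using sE no3[OF uv(1), of x] by (auto simp: U_def)
        have "h x \<in> W" using hW 1 .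
        \<comment> \<open>Otherwise \<open>u, x, h x, v\<close> would be a 4-cycle. Hence
          \<open>x\<close> exchanges its neighbour \<open>u\<close> for a genuinely new one.\<close>
        then have "(x, h x) \<notin> E"
          using no4[of u x "h x" v] 1 sE uv by (auto simp: U_def W_def)
        moreover have "(A \<union> M) `` {x} = insert (h x) (E `` {x} - {u})"
          using Ax M_U[OF 1] xu by auto
        ultimately show ?thesis
          using card_swap_elem[OF finN, of u x "h x"] xu deg xV by auto
      next
        case 2
        have "x \<in> W" using hW 2 by simp
        then have xv: "(x, v) \<in> E" "(x, u) \<notin> E" using sE no3[OF uv(1)] by (auto simp: W_def)
        then have "(x, y) \<notin> E"
          using no4[of u y x v] 2 sE uv \<open>x \<in> W\<close> by (auto simp: U_def W_def)
        moreover have "(A \<union> M) `` {x} = insert y (E `` {x} - {v})"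
          using Ax M_W[OF 2(1)] xv 2 by auto
        ultimately show ?thesis
          using card_swap_elem[OF finN, of v x y] xv deg xV by auto
      next
        case 3
        then have "(x, u) \<notin> E" "(x, v) \<notin> E" using xV sE by (auto simp: U_def W_def)
        moreover have "M `` {x} = {}" using 3 DomM by auto
        ultimately have "(A \<union> M) `` {x} = E `` {x}" using Ax by auto
        then show ?thesis using deg xV by simp
      qed
    qed
    moreover have "M \<subseteq> V' \<times> V'" using UV' hW by (auto simp: M_def)
    moreover have "h x \<noteq> x" if "x \<in> U" for x using hW[OF that] disj that by auto
    then have "irrefl (A \<union> M)" using iE by (fastforce simp: irrefl_def A_def M_def)
    moreover have "sym (A \<union> M)" using symA symM by (rule sym_Un)
    ultimately show ?thesis
      using finV unfolding regular_rel_def by (auto simp: A_def V'_def)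
  qed
  ultimately have "kg_rel k g V' (A \<union> M)"
    unfolding kg_rel_def using cyc' lz by blast
  moreover have "card V' + 2 = card V"
  proof -
    have "card (V - {u, v}) = card V - 2" "2 \<le> card V"
      using uv uvV finV card_mono[of V "{u, v}"] by (auto simp: card_Diff_subset)
    then show ?thesis by (simp add: V'_def)
  qed
  ultimately show ?thesis by (rule that)
qed

subsection \<open>Existence\<close>

text \<open>If short paths are unique, replacing the end edges \<open>ya\<close> and \<open>bz\<close> of a path \<open>y a \<dots> b z\<close> by
  \<open>ab\<close> and \<open>yz\<close> closes the inner path \<open>a \<dots> b\<close> to a cycle and creates no other short cycle.\<close>

lemma kg_rel_switch:
  assumes reg: "regular_rel k V E" and g: "3 \<le> g"
    and uniq: "\<And>ps qs. \<lbrakk>vpath E ps; vpath E qs; hd ps = hd qs; last ps = last qs;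
                  length ps \<le> g + 2; length qs \<le> g + 2\<rbrakk> \<Longrightarrow> ps = qs"
    and path: "vpath E ps" "length ps = g + 2"
  shows "\<exists>E'. kg_rel k g V E'"
proof -
  have finV: "finite V" and EV: "E \<subseteq> V \<times> V" and symE: "sym E" and irr: "irrefl E"
    and deg: "\<And>v. v \<in> V \<Longrightarrow> card (E `` {v}) = k"
    using reg unfolding regular_rel_def by auto
  have sE: "(y, x) \<in> E" if "(x, y) \<in> E" for x y using symE that by (auto dest: symD)
  have iE: "(x, x) \<notin> E" for x using irr by (auto simp: irrefl_def)
  have finN: "finite (E `` {x})" for x
    using finV EV by (auto intro: finite_subset[of _ V])
  obtain y ps' where 1: "ps = y # ps'" using path(2) by (cases ps) auto
  obtain z xs where 2: "ps' = xs @ [z]" using path(2) 1 g by (cases ps' rule: rev_cases) auto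
  have ps: "ps = y # xs @ [z]" using 1 2 by simp
  have lx: "length xs = g" "xs \<noteq> []" using path(2) ps g by auto
  define a b where "a = hd xs" and "b = last xs"
  have px: "vpath E xs" and pyx: "vpath E (y # xs)" and pxz: "vpath E (xs @ [z])"
    and ya: "(y, a) \<in> E" and bz: "(b, z) \<in> E"
    and dxyz: "y \<noteq> z" "y \<notin> set xs" "z \<notin> set xs" "distinct xs"
    using path(1) lx unfolding ps vpath_def
    by (auto simp: successively_append_iff successively_Cons a_def b_def)
  have abx: "a \<in> set xs" "b \<in> set xs" using lx by (auto simp: a_def b_def)
  have "a \<noteq> b" using lx g dxyz(4) by (cases xs) (auto simp: a_def b_def split: if_splits)
  then have ne: "a \<noteq> b" "a \<noteq> y" "a \<noteq> z" "b \<noteq> y" "b \<noteq> z" "y \<noteq> z" using abx dxyz by auto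
  have edge: "vpath E [p, q]" if "(p, q) \<in> E" for p q using that iE by (auto simp: vpath_def)
  \<comment> \<open>An old edge \<open>ab\<close> would be a second short path beside
    \<open>xs\<close>; likewise \<open>yz\<close> beside \<open>ps\<close>. So both new edges are
    really new.\<close>
  have nab: "(a, b) \<notin> E"
  proof
    assume "(a, b) \<in> E"
    from uniq[OF edge[OF this] px] have "[a, b] = xs" using lx g by (simp add: a_def b_def)
    with lx g show False by auto
  qed
  have nyz: "(y, z) \<notin> E"
    using uniq[OF edge path(1), of y z] path(2) g ps by auto
  define R where "R = {(y, a), (a, y), (b, z), (z, b)}"
  define A where "A = E - R"
  define M where "M = {(a, b), (b, a), (y, z), (z, y)}"
  have symA: "sym A" using symE by (auto simp: sym_def A_def R_def)
  have symM: "sym M" by (auto simp: sym_def M_def)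
  have svM: "single_valued M" using ne by (auto simp: single_valued_def M_def)
  have DomM: "Domain M = {a, b, y, z}" by (auto simp: M_def)
  have AE: "A \<subseteq> E" by (auto simp: A_def)
  \<comment> \<open>Each of these lists runs along a removed edge.\<close>
  have npath: "\<not> vpath A (y # xs)" "\<not> vpath A (y # xs @ [z])" "\<not> vpath A (xs @ [z])"
      "\<not> vpath A [y, a]" "\<not> vpath A [b, z]"
    using lx by (auto simp: A_def R_def vpath_def successively_Cons successively_append_iff a_def b_def)
  \<comment> \<open>The pairs are ordered as along \<open>y, a, ..., b, z\<close>. By uniqueness a
    short path between two of these vertices is a piece of \<open>ps\<close>, and every piece except
    \<open>xs\<close> has lost an edge. The conclusion is invariant under reversal, which settles
    the opposite pairs.\<close>
  have half: "ys = xs \<or> ys = rev xs \<or> g + 2 < length ys"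
    if ys: "vpath A ys"
      and e: "(hd ys, last ys) \<in> {(a, b), (y, a), (y, b), (y, z), (a, z), (b, z)}" for ys
  proof (cases "g + 2 < length ys")
    case False
    note u = uniq[OF vpath_mono[OF ys AE]]
    have "ys = xs" if "hd ys = a" "last ys = b"
      using u[OF px] that lx False by (simp add: a_def b_def)
    moreover have "ys = [y, a]" if "hd ys = y" "last ys = a"
      using u[OF edge[OF ya]] that False by simp
    moreover have "ys = y # xs" if "hd ys = y" "last ys = b"
      using u[OF pyx] that lx False by (simp add: b_def)
    moreover have "ys = y # xs @ [z]" if "hd ys = y" "last ys = z"
      using u[OF path(1)] that lx False ps by simp
    moreover have "ys = xs @ [z]" if "hd ys = a" "last ys = z"
      using u[OF pxz] that lx False by (simp add: a_def)
    moreover have "ys = [b, z]" if "hd ys = b" "last ys = z"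
      using u[OF edge[OF bz]] that False by simp
    ultimately show ?thesis using e ys npath by auto
  qed auto
  have far: "length ys = g \<or> g + 2 \<le> length ys"
    if ys: "vpath A ys" "hd ys \<in> Domain M" "last ys \<in> Domain M" "hd ys \<noteq> last ys" for ys
  proof -
    let ?S = "{(a, b), (y, a), (y, b), (y, z), (a, z), (b, z)}"
    have ne': "ys \<noteq> []" using ys by (auto simp: vpath_def)
    have "(hd ys, last ys) \<in> ?S \<or> (last ys, hd ys) \<in> ?S" using ys unfolding DomM by auto
    then have "(ys = xs \<or> ys = rev xs \<or> g + 2 < length ys) \<or>
        (rev ys = xs \<or> rev ys = rev xs \<or> g + 2 < length (rev ys))"
      using half[OF ys(1)] half[of "rev ys"] ys(1) ne' vpath_rev[OF symA, of ys]
      by (simp only: hd_rev last_rev) blast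
    then show ?thesis using lx by auto
  qed
  have cyc': "length cs = g \<or> g + 2 \<le> length cs" if cyc: "vcycle (A \<union> M) cs" for cs
  proof (rule vcycle_splice[OF cyc symM svM, of g])
    show "g \<le> length ys" if "vpath A ys" "hd ys \<in> Domain M" "last ys \<in> Domain M" "hd ys \<noteq> last ys" for ys
      using far[OF that] by auto
  next
    \<comment> \<open>A cycle with at most \<open>g + 2\<close> vertices would give two short paths
      with the same ends: the list itself and its closing edge.\<close>
    assume "vcycle A cs"
    then have c: "vpath E cs" "3 \<le> length cs" "(last cs, hd cs) \<in> E"
      using vpath_mono[of A cs E] AE by (auto simp: vcycle_def)
    then have "vpath E [hd cs, last cs]" using edge sE by blast
    from uniq[OF c(1) this] have "cs = [hd cs, last cs]" if "length cs \<le> g + 2"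
      using that by simp
    then have "length cs = 2" if "length cs \<le> g + 2"
      using that by (metis length_Cons list.size(3) numeral_2_eq_2)
    then show ?thesis using c(2) by fastforce
  next
    fix ys assume ys: "vpath A ys" "(last ys, hd ys) \<in> M" "length ys = length cs"
    then have "hd ys \<in> Domain M" "last ys \<in> Domain M" "hd ys \<noteq> last ys"
      using ne by (auto simp: M_def)
    then show ?thesis using far ys by metis
  qed (use g in auto)
  have "vpath A xs"
    using px dxyz by (auto simp: vpath_def A_def R_def elim!: successively_mono)
  then have "vcycle (A \<union> M) xs"
    using lx g vpath_mono[of A xs "A \<union> M"] by (auto simp: vcycle_def M_def a_def b_def)
  moreover have "regular_rel k V (A \<union> M)"
  proof -
    have inV: "a \<in> V" "b \<in> V" "y \<in> V" "z \<in> V" using ya bz EV by auto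
    have swap: "card (insert q (E `` {x} - {p})) = k" if "x \<in> V" "(x, p) \<in> E" "(x, q) \<notin> E" for x p q
      using card_swap_elem[OF finN, of p x q] that deg by auto
    have "card ((A \<union> M) `` {x}) = k" if x: "x \<in> V" for x
    proof -
      consider "x = a" | "x = b" | "x = y" | "x = z" | "x \<notin> {a, b, y, z}" by blast
      then show ?thesis
      proof cases
        case 1
        then have "(A \<union> M) `` {x} = insert b (E `` {x} - {y})"
          using ne by (auto simp: A_def R_def M_def)
        then show ?thesis using swap[OF x, of y b] 1 nab sE ya by simp
      next
        case 2
        then have "(A \<union> M) `` {x} = insert a (E `` {x} - {z})"
          using ne by (auto simp: A_def R_def M_def)
        then show ?thesis using swap[OF x, of z a] 2 nab sE bz by auto
      next
        case 3
        then have "(A \<union> M) `` {x} = insert z (E `` {x} - {a})"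
          using ne by (auto simp: A_def R_def M_def)
        then show ?thesis using swap[OF x, of a z] 3 nyz sE ya by simp
      next
        case 4
        then have "(A \<union> M) `` {x} = insert y (E `` {x} - {b})"
          using ne by (auto simp: A_def R_def M_def)
        then show ?thesis using swap[OF x, of b y] 4 nyz sE bz by auto
      next
        case 5
        then have "(A \<union> M) `` {x} = E `` {x}"
          by (auto simp: A_def R_def M_def)
        then show ?thesis using deg x by simp
      qed
    qed
    moreover have "M \<subseteq> V \<times> V" using inV by (auto simp: M_def)
    moreover have "irrefl (A \<union> M)" using iE ne by (auto simp: irrefl_def A_def M_def)
    moreover have "sym (A \<union> M)" using symA symM by (rule sym_Un)
    ultimately show ?thesis
      using finV EV unfolding regular_rel_def by (auto simp: A_def)
  qed
  ultimately have "kg_rel k g V (A \<union> M)"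
    unfolding kg_rel_def using cyc' lx by blast
  then show ?thesis by blast
qed

text \<open>The words in \<open>rwords k r\<close> are the vertices of the ball of radius \<open>r\<close> in the \<open>k\<close>-regular tree
  with properly \<open>k\<close>-coloured edges, and \<open>flip k r i\<close> swaps the ends of every edge of colour \<open>i\<close>.
  A path of length at most \<open>r\<close> in the Cayley graph of these involutions can be read off from
  the image of the centre \<open>[]\<close> of the ball.\<close>

definition rwords :: "nat \<Rightarrow> nat \<Rightarrow> nat list set" where
  "rwords k r = {w. set w \<subseteq> {..<k} \<and> length w \<le> r \<and> distinct_adj w}"

definition flip :: "nat \<Rightarrow> nat \<Rightarrow> nat \<Rightarrow> nat list \<Rightarrow> nat list" where
  "flip k r i w = (if w \<in> rwords k r \<and> w \<noteq> [] \<and> hd w = i then tl w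
     else if i # w \<in> rwords k r then i # w else w)"

section \<open>The flips as involutions of the ball\<close>

lemma finite_rwords: "finite (rwords k r)"
  by (rule finite_subset[OF _ finite_lists_length_le[of "{..<k}" r]]) (auto simp: rwords_def)

lemma rwords_ConsD: "i # w \<in> rwords k r \<Longrightarrow> w \<in> rwords k r \<and> (w \<noteq> [] \<longrightarrow> hd w \<noteq> i)"
  by (cases w) (auto simp: rwords_def)

text \<open>The words \<open>v\<close> and \<open>i # v\<close> trade places whenever
  \<open>i # v\<close> is in the ball, and all other words are fixed. No word is in two such pairs,
  because \<open>hd v \<noteq> i\<close>.\<close>

lemma flip_flip [simp]: "flip k r i (flip k r i w) = w"
proof (cases "w \<in> rwords k r \<and> w \<noteq> [] \<and> hd w = i")
  case True
  then obtain v where "w = i # v" by (cases w) auto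
  with True show ?thesis using rwords_ConsD[of i v] by (auto simp: flip_def)
next
  case False
  then show ?thesis by (auto simp: flip_def)
qed

lemma flip_permutes: "flip k r i permutes rwords k r"
  unfolding permutes_def
proof (intro conjI allI impI)
  show "\<exists>!x. flip k r i x = w" for w by (metis flip_flip)
  show "flip k r i w = w" if "w \<notin> rwords k r" for w
    using that rwords_ConsD by (auto simp: flip_def)
qed

lemma flip_Cons: "i # w \<in> rwords k r \<Longrightarrow> flip k r i w = i # w"
  using rwords_ConsD[of i w k r] by (auto simp: flip_def)

text \<open>The vertices are all permutations of the ball, so this is a disjoint union of copies of
  the Cayley graph of the group generated by the flips.\<close>

definition perm_arcs :: "nat \<Rightarrow> nat \<Rightarrow> (nat list \<Rightarrow> nat list) rel" where
  "perm_arcs k r = {(f, flip k r i \<circ> f) |f i. f permutes rwords k r \<and> i < k}"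

lemma flip_comp_permutes: "f permutes rwords k r \<Longrightarrow> flip k r i \<circ> f permutes rwords k r"
  by (rule permutes_compose[OF _ flip_permutes])

lemma flip_comp_flip_comp [simp]: "flip k r i \<circ> (flip k r i \<circ> f) = f"
  by (auto simp: fun_eq_iff)

lemma perm_arcs_sym: "sym (perm_arcs k r)"
proof (rule symI)
  fix f h assume "(f, h) \<in> perm_arcs k r"
  then obtain i where i: "h = flip k r i \<circ> f" "f permutes rwords k r" "i < k"
    by (auto simp: perm_arcs_def)
  then have "f = flip k r i \<circ> h" "h permutes rwords k r" by (auto intro: flip_comp_permutes)
  then show "(h, f) \<in> perm_arcs k r" using i(3) by (auto simp: perm_arcs_def)
qed

text \<open>Evaluating the vertices of a walk from \<open>f\<close> at such an \<open>x\<close>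
  follows the centre of the ball along the walk.\<close>

lemma permutes_obtain_Nil:
  assumes "f permutes S" obtains x where "f x = []"
  using permutes_surj[OF assms] by (metis surjD)

text \<open>For \<open>r \<ge> 1\<close> the flip of colour \<open>i\<close> moves the centre to
  \<open>[i]\<close>, so the \<open>k\<close> flips are distinct and none fixes the centre.\<close>

lemma perm_arcs_regular:
  assumes "1 \<le> r"
  shows "regular_rel k {f. f permutes rwords k r} (perm_arcs k r)"
proof -
  have flip_Nil: "flip k r i [] = [i]" if "i < k" for i
    using that assms by (intro flip_Cons) (auto simp: rwords_def)
  have inj: "i = j" if "flip k r i \<circ> f = flip k r j \<circ> f" "f permutes rwords k r" "i < k" "j < k" for i j f
  proof -
    from permutes_obtain_Nil[OF that(2)] obtain x where "f x = []" .
    with that(1) have "flip k r i [] = flip k r j []" by (metis comp_apply)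
    then show ?thesis using flip_Nil that by simp
  qed
  have "card (perm_arcs k r `` {f}) = k" if f: "f permutes rwords k r" for f
  proof -
    have "perm_arcs k r `` {f} = (\<lambda>i. flip k r i \<circ> f) ` {..<k}"
      using f by (auto simp: perm_arcs_def)
    moreover have "inj_on (\<lambda>i. flip k r i \<circ> f) {..<k}"
      using inj f by (auto simp: inj_on_def)
    ultimately show ?thesis by (simp add: card_image)
  qed
  moreover have "flip k r i \<circ> f \<noteq> f" if "f permutes rwords k r" "i < k" for f i
  proof
    assume eq: "flip k r i \<circ> f = f"
    from permutes_obtain_Nil[OF that(1)] obtain x where "f x = []" .
    with eq have "flip k r i [] = []" by (metis comp_apply)
    then show False using flip_Nil that by simp
  qed
  then have "irrefl (perm_arcs k r)"
    by (auto simp: irrefl_def perm_arcs_def) metis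
  ultimately show ?thesis
    using finite_permutations[OF finite_rwords] perm_arcs_sym flip_comp_permutes
    unfolding regular_rel_def by (auto simp: perm_arcs_def)
qed

text \<open>Walks are traced backwards, so that the list of vertices of the walk and the word of its
  colours both grow at the head.\<close>

primrec trace :: "nat \<Rightarrow> nat \<Rightarrow> (nat list \<Rightarrow> nat list) \<Rightarrow> nat list \<Rightarrow> (nat list \<Rightarrow> nat list) list" where
  "trace k r f [] = [f]"
| "trace k r f (i # w) = (flip k r i \<circ> hd (trace k r f w)) # trace k r f w"

lemma trace_neq_Nil [simp]: "trace k r f w \<noteq> []"
  by (cases w) auto

lemma length_trace [simp]: "length (trace k r f w) = Suc (length w)"
  by (induction w) auto

lemma last_trace [simp]: "last (trace k r f w) = f"
  by (induction w) auto

text \<open>All suffixes of \<open>w\<close> stay in the ball, so each flip just prepends its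
  colour.\<close>

lemma hd_trace_apply:
  "f x = [] \<Longrightarrow> w \<in> rwords k r \<Longrightarrow> hd (trace k r f w) x = w"
  by (induction w) (simp_all add: flip_Cons rwords_ConsD)

lemma vpath_perm_arcs_trace:
  assumes "vpath (perm_arcs k r) qs"
  shows "\<exists>w. qs = trace k r (last qs) w \<and> set w \<subseteq> {..<k} \<and> distinct_adj w"
  using assms
proof (induction qs)
  case Nil
  then show ?case by (simp add: vpath_def)
next
  case (Cons q qs)
  show ?case
  proof (cases "qs = []")
    case True
    then show ?thesis by (intro exI[of _ "[]"]) auto
  next
    case False
    with Cons.prems have q: "q \<notin> set qs" "(q, hd qs) \<in> perm_arcs k r" "vpath (perm_arcs k r) qs"
      by (auto simp: vpath_Cons)
    obtain w where w: "qs = trace k r (last qs) w" "set w \<subseteq> {..<k}" "distinct_adj w"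
      using Cons.IH[OF q(3)] by blast
    obtain i where i: "i < k" "q = flip k r i \<circ> hd qs"
      using symD[OF perm_arcs_sym q(2)] by (auto simp: perm_arcs_def)
    have "distinct_adj (i # w)"
    proof (cases w)
      case (Cons j v)
      \<comment> \<open>Flips are involutions, so repeating a colour would return to the vertex two
        steps back, which a path cannot do.\<close>
      have "i \<noteq> j"
      proof
        assume "i = j"
        have qs: "qs = (flip k r j \<circ> hd (trace k r (last qs) v)) # trace k r (last qs) v"
          using w(1) Cons by simp
        then have "hd qs = flip k r j \<circ> hd (trace k r (last qs) v)" by (metis list.sel(1))
        then have "q = hd (trace k r (last qs) v)"
          using i(2) \<open>i = j\<close> by simp
        moreover have "hd (trace k r (last qs) v) \<in> set qs"
          by (subst (2) qs) simp
        ultimately show False using q(1) by simp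
      qed
      then show ?thesis using w(3) Cons by simp
    qed simp
    moreover have "q # qs = trace k r (last (q # qs)) (i # w)"
      using i(2) w(1) False by simp
    ultimately show ?thesis using w(2) i(1) by (intro exI[of _ "i # w"]) auto
  qed
qed

text \<open>At most \<open>Suc r\<close> vertices mean a colour word of length at most
  \<open>r\<close>, which lies in the ball. It is the value of the head at the point that the last
  vertex sends to \<open>[]\<close>, so the ends determine the whole path.\<close>

lemma perm_arcs_path_unique:
  assumes "vpath (perm_arcs k r) ps" "vpath (perm_arcs k r) qs" "hd ps = hd qs" "last ps = last qs"
    and "length ps \<le> Suc r" "length qs \<le> Suc r"
  shows "ps = qs"
proof (cases "2 \<le> length ps \<or> 2 \<le> length qs")
  case False
  then have "ps = [hd ps]" "qs = [hd qs]"
    using assms(1,2) by (cases ps; cases "tl ps"; cases qs; cases "tl qs"; auto simp: vpath_def)+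
  then show ?thesis using assms(3) by metis
next
  case True
  have "perm_arcs k r \<subseteq> {f. f permutes rwords k r} \<times> {f. f permutes rwords k r}"
    using flip_comp_permutes by (auto simp: perm_arcs_def)
  then have "set ps \<subseteq> {f. f permutes rwords k r} \<or> set qs \<subseteq> {f. f permutes rwords k r}"
    using True vpath_subset[OF assms(1)] vpath_subset[OF assms(2)] by blast
  then have "last ps permutes rwords k r"
    using assms(1,2,4) by (metis last_in_set mem_Collect_eq subsetD vpath_def)
  then obtain x where x: "last ps x = []" by (rule permutes_obtain_Nil)
  obtain v w where v: "ps = trace k r (last ps) v" "set v \<subseteq> {..<k}" "distinct_adj v"
    and w: "qs = trace k r (last ps) w" "set w \<subseteq> {..<k}" "distinct_adj w"
    using vpath_perm_arcs_trace[OF assms(1)] vpath_perm_arcs_trace[OF assms(2)] assms(4) by metis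
  have "length v \<le> r" "length w \<le> r"
    using assms(5,6) v(1) w(1) by (metis Suc_le_mono length_trace)+
  then have "hd ps x = v" "hd qs x = w"
    using hd_trace_apply[of "last ps" x v k r] hd_trace_apply[of "last ps" x w k r] x v w by (auto simp: rwords_def)
  then show ?thesis using assms(3) v(1) w(1) by metis
qed

section \<open>Long paths in the Cayley graph\<close>

lemma trace_apply_length:
  "f x = [] \<Longrightarrow> w \<in> rwords k r \<Longrightarrow> h \<in> set (trace k r f w) \<Longrightarrow> length (h x) \<le> length w"
proof (induction w)
  case (Cons i w)
  then have "hd (trace k r f (i # w)) x = i # w" by (intro hd_trace_apply)
  with Cons show ?case using rwords_ConsD[of i w k r] by fastforce
qed auto

text \<open>Each added vertex is new: it sends \<open>x\<close> to \<open>i # w\<close>, whereas the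
  vertices so far send \<open>x\<close> to words no longer than \<open>w\<close>.\<close>

lemma vpath_trace:
  assumes "f permutes rwords k r" "w \<in> rwords k r"
  shows "vpath (perm_arcs k r) (trace k r f w) \<and> hd (trace k r f w) permutes rwords k r"
  using assms(2)
proof (induction w)
  case Nil
  show ?case using assms(1) by (simp add: vpath_def)
next
  case (Cons i w)
  let ?h = "hd (trace k r f w)"
  have w: "w \<in> rwords k r" "i < k" using Cons.prems rwords_ConsD[of i w] by (auto simp: rwords_def)
  then have IH: "vpath (perm_arcs k r) (trace k r f w)" "?h permutes rwords k r"
    using Cons.IH by blast+
  from permutes_obtain_Nil[OF assms(1)] obtain x where x: "f x = []" .
  have "(?h, flip k r i \<circ> ?h) \<in> perm_arcs k r"
    using IH(2) w(2) unfolding perm_arcs_def by blast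
  then have arc: "(flip k r i \<circ> ?h, ?h) \<in> perm_arcs k r"
    by (rule symD[OF perm_arcs_sym])
  have "(flip k r i \<circ> ?h) x = i # w"
    using hd_trace_apply[of f x "i # w" k r] x Cons.prems by simp
  then have "flip k r i \<circ> ?h \<notin> set (trace k r f w)"
    using trace_apply_length[of f x w k r "flip k r i \<circ> ?h"] x w(1) by auto
  with arc have "vpath (perm_arcs k r) (trace k r f (i # w))"
    using IH(1) by (simp add: vpath_Cons)
  moreover have "hd (trace k r f (i # w)) permutes rwords k r"
    using flip_comp_permutes[OF IH(2)] by (simp only: trace.simps list.sel)
  ultimately show ?case ..
qed

text \<open>Two colours in alternation already give words of every length without equal
  neighbours.\<close>

lemma alternating_rword:
  assumes "2 \<le> k"
  shows "map (\<lambda>i. i mod 2) [0..<n] \<in> rwords k n"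
proof -
  have "i mod 2 < k" for i using assms by (meson less_le_trans mod_less_divisor zero_less_numeral)
  moreover have "i mod 2 \<noteq> Suc i mod 2" for i by presburger
  ultimately show ?thesis by (auto simp: rwords_def distinct_adj_conv_nth)
qed

text \<open>Radius \<open>g + 1\<close> makes paths on up to \<open>g + 2\<close> vertices unique,
  and a colour word of length \<open>g + 1\<close> traces a path on exactly \<open>g + 2\<close>
  vertices, as the switch demands.\<close>

lemma kg_rel_exists:
  assumes "2 \<le> k" "3 \<le> g"
  shows "\<exists>E. kg_rel k g {f. f permutes rwords k (g + 1)} E"
proof (rule kg_rel_switch[OF perm_arcs_regular assms(2)])
  let ?w = "map (\<lambda>i. i mod 2) [0..<g + 1]"
  show "vpath (perm_arcs k (g + 1)) (trace k (g + 1) id ?w)"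
    using vpath_trace[OF permutes_id alternating_rword[OF assms(1)]] by blast
  show "ps = qs" if "vpath (perm_arcs k (g + 1)) ps" "vpath (perm_arcs k (g + 1)) qs" "hd ps = hd qs"
    "last ps = last qs" "length ps \<le> g + 2" "length qs \<le> g + 2" for ps qs
    using that by (intro perm_arcs_path_unique[of k "g + 1"]) auto
qed auto

theorem theorem1:
  fixes k g :: nat
  assumes "k \<ge> 2" and "g \<ge> 3"
  shows "int (min_order k g) \<le> int (min_order k (g + 2)) - 2"
proof -
  obtain V :: "(nat list \<Rightarrow> nat list) set" and E where "kg_rel k (g + 2) V E"
    using kg_rel_exists[of k "g + 2"] assms by auto
  then have "\<exists>n. \<exists>G :: nat pair_pre_digraph. is_kg_graph k (g + 2) G \<and> card (pverts G) = n"
    using kg_rel_imp_nat by blast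
  then have "\<exists>G :: nat pair_pre_digraph. is_kg_graph k (g + 2) G \<and> card (pverts G) = min_order k (g + 2)"
    unfolding min_order_def by (rule LeastI_ex)
  then obtain G :: "nat pair_pre_digraph"
    where G: "kg_rel k (g + 2) (pverts G) (parcs G)" "card (pverts G) = min_order k (g + 2)"
    by (auto simp: is_kg_graph_iff)
  obtain V' :: "nat set" and E' where V': "kg_rel k g V' E'" "card V' + 2 = min_order k (g + 2)"
    using kg_rel_delete_edge[OF G(1) assms(2)] G(2) by metis
  have "min_order k g \<le> card V'"
    unfolding min_order_def by (rule Least_le) (rule kg_rel_imp_nat[OF V'(1)])
  with V'(2) show ?thesis by linarith
qed

end
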